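(* If $G\in\mathcal{G}$, then $$\alpha(G)\ge \tfrac{2}{3}|V_1(G)|+\tfrac{1}{3}|V_2(G)|+\tfrac{1}{3}|V_3(G)|,$$ and equality holds if $G\in\mathcal{A}\cup\mathcal{B}$.
   Context: Graphs are finite, simple and undirected. $\mathcal{G}$ denotes the class of all connected graphs $G$ with maximum degree at most $3$, with $G\neq K_4$ and $|V(G)|\ge 3$. For $i\in\{1,2,3\}$, $V_i(G)=\{v\in V(G): d_G(v)=i\}$, where $d_G(v)$ is the degree of $v$. $\alpha(G)$ is the independence number of $G$. The class $\mathcal{A}$ is defined recursively: $K_3\in\mathcal{A}$; and if $G'\in\mathcal{A}$ and $x$ is a vertex of degree $2$ in $G'$, then the graph obtained from the disjoint union of $G'$ and a triangle $K_3$ by adding one edge between $x$ and a vertex of the triangle belongs to $\mathcal{A}$. The class $\mathcal{B}$ consists of all graphs obtained from a path $P_n$ on $n\ge 2$ vertices by attaching one pendant edge (to a new vertex) at every vertex of $P_n$. *)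

theory Defs
  imports Complex_Main "Graph_Theory.Graph_Theory"
begin

text \<open>
  A finite simple undirected graph is a \<open>pair_graph\<close>: a finite, loop-free digraph
  with symmetric arc relation, so that an edge \<open>uv\<close> is the pair of arcs \<open>(u, v)\<close>, \<open>(v, u)\<close>.
  Hence the degree of a vertex is its out-degree (equivalently, its in-degree), and the
  predicate \<open>complete_digraph n\<close> says that a graph is a copy of the complete graph on \<open>n\<close>
  vertices. All graph classes below are closed under isomorphism within the vertex type.
\<close>

definition degree_class :: "'a pair_pre_digraph \<Rightarrow> nat \<Rightarrow> 'a set" where
  "degree_class G i = {v \<in> pverts G. out_degree (with_proj G) v = i}"

definition independent_set :: "'a pair_pre_digraph \<Rightarrow> 'a set \<Rightarrow> bool" where
  "independent_set G S \<longleftrightarrow> S \<subseteq> pverts G \<and> (\<forall>u \<in> S. \<forall>v \<in> S. (u, v) \<notin> parcs G)"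

definition independence_number :: "'a pair_pre_digraph \<Rightarrow> nat" where
  "independence_number G = Max (card ` {S. independent_set G S})"

definition class_G :: "'a pair_pre_digraph set" where
  "class_G = {G. pair_graph G \<and> Digraph_Component.connected (with_proj G) \<and>
     (\<forall>v \<in> pverts G. out_degree (with_proj G) v \<le> 3) \<and>
     \<not> complete_digraph 4 (with_proj G) \<and> card (pverts G) \<ge> 3}"

inductive_set class_A :: "'a pair_pre_digraph set" where
  triangle: "complete_digraph 3 (with_proj T) \<Longrightarrow> T \<in> class_A"
| attach_triangle: "\<lbrakk>G \<in> class_A; x \<in> pverts G; out_degree (with_proj G) x = 2;
     complete_digraph 3 (with_proj T); pverts G \<inter> pverts T = {}; y \<in> pverts T\<rbrakk>
   \<Longrightarrow> \<lparr>pverts = pverts G \<union> pverts T,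
        parcs = parcs G \<union> parcs T \<union> {(x, y), (y, x)}\<rparr> \<in> class_A"

definition path_graph :: "nat \<Rightarrow> 'a pair_pre_digraph \<Rightarrow> bool" where
  "path_graph n P \<longleftrightarrow> (\<exists>vs. length vs = n \<and> distinct vs \<and> pverts P = set vs \<and>
     parcs P = {(vs ! i, vs ! Suc i) |i. Suc i < n} \<union> {(vs ! Suc i, vs ! i) |i. Suc i < n})"

text \<open>In \<open>class_B\<close>, \<open>f v\<close> is the new end vertex of the pendant edge attached at \<open>v\<close>.\<close>

definition class_B :: "'a pair_pre_digraph set" where
  "class_B = {G. \<exists>n P f. n \<ge> 2 \<and> path_graph n P \<and>
     inj_on f (pverts P) \<and> f ` pverts P \<inter> pverts P = {} \<and>
     G = \<lparr>pverts = pverts P \<union> f ` pverts P,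
          parcs = parcs P \<union> {(v, f v) |v. v \<in> pverts P} \<union> {(f v, v) |v. v \<in> pverts P}\<rparr>}"

end

theory Submission
  imports Defs
begin

text \<open>
  The main step is that a subcubic graph without \<open>K\<^sub>4\<close> has a stable set containing a third of its
  vertices, shown by induction. Without triangles, a maximum stable set works. Otherwise delete a
  triangle \<open>T\<close>. If some vertex of \<open>T\<close> has no neighbour outside \<open>T\<close>, it can be added to the stable
  set of the rest. Otherwise two vertices \<open>x, y\<close> of \<open>T\<close> have different outside neighbours \<open>p, q\<close>;
  after joining \<open>p\<close> and \<open>q\<close> by a new edge the stable set of the rest misses one of them, so \<open>x\<close> or
  \<open>y\<close> can be added. Should the new edge create a \<open>K\<^sub>4\<close>, the closed neighbourhoods of \<open>p\<close> and \<open>q\<close>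
  together have only six vertices and can be deleted instead.
\<close>

section \<open>Stable sets of a third of the vertices in subcubic graphs\<close>

definition nbrs :: "'a rel \<Rightarrow> 'a set \<Rightarrow> 'a \<Rightarrow> 'a set" where
  "nbrs E V v = {w \<in> V. (v, w) \<in> E}"

definition stable_set :: "'a rel \<Rightarrow> 'a set \<Rightarrow> bool" where
  "stable_set E S \<longleftrightarrow> (\<forall>u \<in> S. \<forall>v \<in> S. (u, v) \<notin> E)"

definition clique :: "'a rel \<Rightarrow> 'a set \<Rightarrow> bool" where
  "clique E K \<longleftrightarrow> (\<forall>u \<in> K. \<forall>v \<in> K. u \<noteq> v \<longrightarrow> (u, v) \<in> E)"

text \<open>Under the degree bound, three known neighbours exhaust a neighbourhood. This is how
  vertices on a triangle or in a near-K4 are shown to have no further edges.\<close>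

lemma nbrs_eq_triple:
  assumes "finite V" "card (nbrs E V v) \<le> 3"
    and "a \<in> nbrs E V v" "b \<in> nbrs E V v" "c \<in> nbrs E V v" "a \<noteq> b" "a \<noteq> c" "b \<noteq> c"
  shows "nbrs E V v = {a, b, c}"
proof (rule card_seteq[symmetric])
  show "finite (nbrs E V v)" using assms(1) by (simp add: nbrs_def)
  show "{a, b, c} \<subseteq> nbrs E V v" using assms by auto
  show "card (nbrs E V v) \<le> card {a, b, c}" using assms by auto
qed

text \<open>Since \<open>A\<close> sends no edge out of \<open>R\<close>, it combines with any
  stable set of \<open>V - R\<close>. The ratio of one third holds on both parts and therefore on
  their union.\<close>

lemma stable_extend:
  assumes "finite V" "sym E" "A \<subseteq> R" "R \<subseteq> V" "stable_set E A" "card R \<le> 3 * card A"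
    and nb: "\<And>a. a \<in> A \<Longrightarrow> nbrs E V a \<subseteq> R"
    and S: "S \<subseteq> V - R" "stable_set E S" "card (V - R) \<le> 3 * card S"
  shows "\<exists>S \<subseteq> V. stable_set E S \<and> card V \<le> 3 * card S"
proof (intro exI conjI)
  show "A \<union> S \<subseteq> V" using assms by auto
  have "(a, s) \<notin> E" if "a \<in> A" "s \<in> S" for a s
    using nb[OF that(1)] that(2) S(1) by (auto simp: nbrs_def)
  then show "stable_set E (A \<union> S)"
    using assms(2,5) S(2) by (auto simp: stable_set_def dest: symD)
  have "finite R" using assms(1,4) finite_subset by blast
  then have "card V = card R + card (V - R)"
    using assms(1,4) by (metis card_Diff_subset card_mono le_add_diff_inverse)
  moreover have "card (A \<union> S) = card A + card S"
  proof (rule card_Un_disjoint)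
    show "finite A" "finite S" "A \<inter> S = {}"
      using \<open>finite R\<close> assms finite_subset[of A R] finite_subset[of S "V - R"] by auto
  qed
  ultimately show "card V \<le> 3 * card (A \<union> S)" using assms(6) S(3) by simp
qed

text \<open>In a maximum stable set \<open>I\<close> of a triangle-free graph, two outside vertices cannot have the
  same vertex of \<open>I\<close> as their only neighbour in \<open>I\<close>, as swapping would enlarge \<open>I\<close>.
  Hence at most \<open>card I\<close> outside vertices send fewer than two edges to \<open>I\<close>.\<close>

lemma triangle_free_stable:
  assumes "finite V" "sym E" "irrefl E" and deg: "\<And>v. v \<in> V \<Longrightarrow> card (nbrs E V v) \<le> 3"
    and tf: "\<And>u v w. \<lbrakk>u \<in> V; v \<in> V; w \<in> V; (u, v) \<in> E; (u, w) \<in> E\<rbrakk> \<Longrightarrow> (v, w) \<notin> E"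
  shows "\<exists>S \<subseteq> V. stable_set E S \<and> card V \<le> 3 * card S"
proof -
  define F where "F = {S. S \<subseteq> V \<and> stable_set E S}"
  have "finite F" "{} \<in> F" using assms(1) by (auto simp: F_def stable_set_def)
  then have "Max (card ` F) \<in> card ` F" by (intro Max_in) auto
  then obtain I where I: "I \<in> F" and I_max: "Max (card ` F) = card I" by (rule imageE)
  have max: "card S \<le> card I" if "S \<in> F" for S
    using \<open>finite F\<close> that unfolding I_max[symmetric] by (intro Max_ge finite_imageI imageI)
  have IV: "I \<subseteq> V" and stI: "stable_set E I" using I by (auto simp: F_def)
  have finI: "finite I" using IV assms(1) finite_subset by blast
  define W where "W = V - I"
  have finW: "finite W" using assms(1) by (simp add: W_def)
  define k where "k w = card {v \<in> I. (v, w) \<in> E}" for w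
  define P where "P = {w \<in> W. k w = 1}"
  \<comment> \<open>A vertex without neighbours in \<open>I\<close> could be added to
    \<open>I\<close>, against maximality.\<close>
  have k_pos: "k w \<ge> 1" if "w \<in> W" for w
  proof (rule ccontr)
    assume "\<not> k w \<ge> 1"
    then have "card {v \<in> I. (v, w) \<in> E} = 0" unfolding k_def by linarith
    then have "{v \<in> I. (v, w) \<in> E} = {}" using finI by simp
    then have "stable_set E (insert w I)"
      using stI assms(2,3) by (auto simp: stable_set_def irrefl_def dest: symD)
    then have "card (insert w I) \<le> card I" using max IV that by (auto simp: W_def F_def)
    then show False using that finI by (auto simp: W_def)
  qed
  have "card P \<le> card I"
  proof -
    define g where "g w = (THE v. v \<in> I \<and> (v, w) \<in> E)" for w
    have ex1: "\<exists>!v. v \<in> I \<and> (v, w) \<in> E" if "w \<in> P" for w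
    proof -
      have "card {v \<in> I. (v, w) \<in> E} = 1" using that by (simp add: P_def k_def)
      then obtain x where "{v \<in> I. (v, w) \<in> E} = {x}" by (rule card_1_singletonE)
      then show ?thesis by (intro ex1I[of _ x]) auto
    qed
    have g: "g w \<in> I \<and> (g w, w) \<in> E" if "w \<in> P" for w
      unfolding g_def by (rule theI') (rule ex1[OF that])
    have gu: "v = g w" if "w \<in> P" "v \<in> I" "(v, w) \<in> E" for v w
      using ex1[OF that(1)] g[OF that(1)] that by blast
    have "inj_on g P"
    proof (rule inj_onI, rule ccontr)
      fix w w' assume w: "w \<in> P" "w' \<in> P" "g w = g w'" "w \<noteq> w'"
      \<comment> \<open>The swap: \<open>g w\<close> leaves \<open>I\<close>, its two private
        neighbours \<open>w\<close> and \<open>w'\<close> enter. They are not adjacent, as they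
        would form a triangle with \<open>g w\<close>.\<close>
      define J where "J = insert w (insert w' (I - {g w}))"
      have mem: "w \<in> V" "w' \<in> V" "w \<notin> I" "w' \<notin> I" using w by (auto simp: P_def W_def)
      have nadj: "(w, w') \<notin> E" using tf[of "g w" w w'] g[OF w(1)] g[OF w(2)] w(3) mem IV by auto
      then have nadj': "(w', w) \<notin> E" using assms(2) by (meson symD)
      have "(v, w) \<notin> E" "(v, w') \<notin> E" if "v \<in> I - {g w}" for v
        using that gu[OF w(1), of v] gu[OF w(2), of v] w(3) by auto
      moreover from this have "(w, v) \<notin> E" "(w', v) \<notin> E" if "v \<in> I - {g w}" for v
        using that assms(2) by (blast dest: symD)+
      ultimately have "stable_set E J"
        using stI assms(3) nadj nadj' by (auto simp: J_def stable_set_def irrefl_def)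
      then have "card J \<le> card I" using max[of J] IV mem by (auto simp: J_def F_def)
      moreover have "card J = Suc (card I)"
        using w(4) mem finI g[OF w(1)] card_Suc_Diff1[of I "g w"] by (simp add: J_def)
      ultimately show False by simp
    qed
    then show ?thesis using g finI by (intro card_inj_on_le[of g]) auto
  qed
  \<comment> \<open>By \<open>k_pos\<close>, a vertex of \<open>W\<close> outside \<open>P\<close>
    has \<open>k w\<close> at least 2; for those in \<open>P\<close> the term \<open>card P\<close>
    supplies the missing 1.\<close>
  moreover have "2 * card W \<le> (\<Sum>w\<in>W. k w) + card P"
  proof -
    have "card P = (\<Sum>w\<in>W. if k w = 1 then 1 else 0)"
      using finW by (simp add: P_def sum.If_cases Int_def)
    moreover have "2 * card W = (\<Sum>w\<in>W. 2)" by simp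
    moreover have "(\<Sum>w\<in>W. 2) \<le> (\<Sum>w\<in>W. k w + (if k w = 1 then 1 else 0))"
    proof (rule sum_mono)
      fix w assume "w \<in> W"
      then show "2 \<le> k w + (if k w = 1 then 1 else 0)" using k_pos[of w] by auto
    qed
    ultimately show ?thesis by (simp add: sum.distrib)
  qed
  \<comment> \<open>Double counting of the edges between \<open>I\<close> and
    \<open>W\<close>.\<close>
  moreover have "(\<Sum>w\<in>W. k w) \<le> 3 * card I"
  proof -
    have "(\<Sum>w\<in>W. k w) = (\<Sum>v\<in>I. card {w \<in> W. (v, w) \<in> E})"
      using sum_multicount_gen[OF finI finW, of "\<lambda>v w. (v, w) \<in> E" k] by (simp add: k_def)
    also have "\<dots> \<le> (\<Sum>v\<in>I. 3)"
    proof (rule sum_mono)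
      fix v assume "v \<in> I"
      have "card {w \<in> W. (v, w) \<in> E} \<le> card (nbrs E V v)"
        using assms(1) by (intro card_mono) (auto simp: nbrs_def W_def)
      then show "card {w \<in> W. (v, w) \<in> E} \<le> 3" using deg \<open>v \<in> I\<close> IV by fastforce
    qed
    finally show ?thesis by simp
  qed
  moreover have "card V = card I + card W"
    using IV assms(1) finI by (simp add: W_def card_Diff_subset card_mono)
  \<comment> \<open>Together \<open>2 * card W\<close> is at most \<open>4 * card I\<close>, so
    \<open>card V\<close> is at most \<open>3 * card I\<close>.\<close>
  ultimately show ?thesis using IV stI by (intro exI[of _ I]) auto
qed

text \<open>Deletions may disconnect the graph, so K4 is excluded as a subgraph, a condition
  inherited by subsets. The vertex set and the relation are separate arguments: deletions shrink
  \<open>V\<close> only, while the new edge between the outside neighbours changes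
  \<open>E\<close>.\<close>

lemma subcubic_stable:
  assumes "finite V" "sym E" "irrefl E" "\<And>v. v \<in> V \<Longrightarrow> card (nbrs E V v) \<le> 3"
    and "\<And>K. \<lbrakk>K \<subseteq> V; card K = 4\<rbrakk> \<Longrightarrow> \<not> clique E K"
  shows "\<exists>S \<subseteq> V. stable_set E S \<and> card V \<le> 3 * card S"
  using assms
proof (induction "card V" arbitrary: V E rule: less_induct)
  case less
  note fin = less.prems(1) and sym = less.prems(2) and irr = less.prems(3)
    and deg = less.prems(4) and noK4 = less.prems(5)
  have symE: "(a, b) \<in> E \<Longrightarrow> (b, a) \<in> E" for a b using sym by (rule symD)
  have irrE: "(a, a) \<notin> E" for a using irr by (simp add: irrefl_def)
  have nbrs_mono: "card (nbrs E (V - R) v) \<le> 3" if "v \<in> V" for R v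
  proof -
    have "card (nbrs E (V - R) v) \<le> card (nbrs E V v)"
      using fin by (intro card_mono) (auto simp: nbrs_def)
    then show ?thesis using deg[OF that] by simp
  qed
  have reduce: ?case
    if "A \<subseteq> R" "R \<subseteq> V" "R \<noteq> {}" "stable_set E A" "card R \<le> 3 * card A"
      and "\<And>a. a \<in> A \<Longrightarrow> nbrs E V a \<subseteq> R" for A R
  proof -
    have "card (V - R) < card V" using that fin by (intro psubset_card_mono) auto
    then obtain S where "S \<subseteq> V - R" "stable_set E S" "card (V - R) \<le> 3 * card S"
      using less.hyps[of "V - R" E] fin sym irr nbrs_mono noK4 by blast
    then show ?thesis using stable_extend[OF fin sym] that by blast
  qed
  show ?case
  proof (cases "\<exists>u \<in> V. \<exists>v \<in> V. \<exists>w \<in> V. (u, v) \<in> E \<and> (u, w) \<in> E \<and> (v, w) \<in> E")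
    case False
    then show ?thesis using triangle_free_stable[OF fin sym irr deg] by blast
  next
    case True
    then obtain u v w where uvw: "u \<in> V" "v \<in> V" "w \<in> V" "(u, v) \<in> E" "(u, w) \<in> E" "(v, w) \<in> E"
      by blast
    then have dist: "u \<noteq> v" "u \<noteq> w" "v \<noteq> w" using irrE by auto
    define T where "T = {u, v, w}"
    have TV: "T \<subseteq> V" and cT: "card T = 3" and finT: "finite T"
      using uvw dist by (auto simp: T_def)
    have cliqueT: "(a, b) \<in> E" if "a \<in> T" "b \<in> T" "a \<noteq> b" for a b
      using that uvw symE by (auto simp: T_def)
    show ?thesis
    proof (cases "\<exists>x \<in> T. nbrs E V x \<subseteq> T")
      case True
      then obtain x where "x \<in> T" "nbrs E V x \<subseteq> T" by blast
      then show ?thesis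
        using reduce[of "{x}" T] TV cT irrE by (auto simp: stable_set_def)
    next
      case False
      \<comment> \<open>An outside neighbour and the two other vertices of \<open>T\<close> use up
        the degree of \<open>x\<close>, so its outside neighbour \<open>h x\<close> is
        unique.\<close>
      have "\<exists>y. y \<in> V - T \<and> (x, y) \<in> E \<and> nbrs E V x \<subseteq> insert y T" if x: "x \<in> T" for x
      proof -
        obtain y where y: "y \<in> nbrs E V x" "y \<notin> T" using False x by blast
        obtain a b where ab: "a \<in> T" "b \<in> T" "a \<noteq> b" "a \<noteq> x" "b \<noteq> x"
          using x dist by (auto simp: T_def)
        then have "nbrs E V x = {y, a, b}"
          using x y TV cliqueT fin deg by (intro nbrs_eq_triple) (auto simp: nbrs_def)
        then show ?thesis using y ab by (auto simp: nbrs_def)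
      qed
      then obtain h where h: "\<And>x. x \<in> T \<Longrightarrow> h x \<in> V - T \<and> (x, h x) \<in> E \<and> nbrs E V x \<subseteq> insert (h x) T"
        by metis
      show ?thesis
      proof (cases "\<exists>x \<in> T. \<exists>y \<in> T. h x \<noteq> h y")
        case False
        \<comment> \<open>A common outside neighbour of all three vertices would complete
          \<open>T\<close> to a K4.\<close>
        then have "h a = h u" if "a \<in> T" for a using that by (auto simp: T_def)
        then have "(a, h u) \<in> E" "(h u, a) \<in> E" if "a \<in> T" for a
          using that h[OF that] symE by auto
        then have "clique E (insert (h u) T)"
          using cliqueT by (auto simp: clique_def)
        moreover have "card (insert (h u) T) = 4" using h cT finT by (auto simp: T_def)
        ultimately show ?thesis using noK4[of "insert (h u) T"] h TV by (auto simp: T_def)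
      next
        case True
        then obtain x y where xy: "x \<in> T" "y \<in> T" "h x \<noteq> h y" by blast
        define p where "p = h x"
        define q where "q = h y"
        have pq: "p \<noteq> q" "p \<in> V - T" "q \<in> V - T" "(p, x) \<in> E" "(q, y) \<in> E" "x \<noteq> y"
          using xy h symE by (auto simp: p_def q_def)
        define E' where "E' = E \<union> {(p, q), (q, p)}"
        have "sym E'" using sym by (auto simp: E'_def sym_def)
        have "irrefl E'" using irr pq by (auto simp: E'_def irrefl_def)
        have deg': "card (nbrs E' (V - T) z) \<le> 3" if z: "z \<in> V - T" for z
        proof -
          \<comment> \<open>The new edge does not raise degrees: \<open>p\<close> gains at most
            \<open>q\<close> and loses \<open>x\<close>, which is deleted with \<open>T\<close>;
            likewise \<open>q\<close> gains at most \<open>p\<close> and loses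
            \<open>y\<close>.\<close>
          have new: "card (nbrs E' (V - T) a) \<le> 3"
            if "nbrs E' (V - T) a \<subseteq> insert b (nbrs E V a - {t})" "t \<in> nbrs E V a" "a \<in> V" for a b t
          proof -
            have f: "finite (nbrs E V a)" using fin by (simp add: nbrs_def)
            have "card (nbrs E' (V - T) a) \<le> card (insert b (nbrs E V a - {t}))"
              using that f by (intro card_mono) auto
            also have "\<dots> \<le> Suc (card (nbrs E V a - {t}))" using f by (simp add: card_insert_if)
            also have "\<dots> = card (nbrs E V a)" using f that(2) by (rule card_Suc_Diff1)
            finally show ?thesis using deg[OF \<open>a \<in> V\<close>] by simp
          qed
          consider "z = p" | "z = q" | "z \<noteq> p" "z \<noteq> q" by blast
          then show ?thesis
          proof cases
            case 1
            have "card (nbrs E' (V - T) p) \<le> 3"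
              using pq xy TV by (intro new[of p q x]) (auto simp: nbrs_def E'_def)
            then show ?thesis using 1 by simp
          next
            case 2
            have "card (nbrs E' (V - T) q) \<le> 3"
              using pq xy TV by (intro new[of q p y]) (auto simp: nbrs_def E'_def)
            then show ?thesis using 2 by simp
          next
            case 3
            then have "nbrs E' (V - T) z = nbrs E (V - T) z" by (auto simp: nbrs_def E'_def)
            then show ?thesis using nbrs_mono z by simp
          qed
        qed
        show ?thesis
        proof (cases "\<exists>K \<subseteq> V - T. card K = 4 \<and> clique E' K")
          case False
          have "card (V - T) < card V" using TV fin finT cT card_mono[OF fin TV]
            by (simp add: card_Diff_subset)
          then obtain S where S: "S \<subseteq> V - T" "stable_set E' S" "card (V - T) \<le> 3 * card S"
            using less.hyps[of "V - T" E'] fin \<open>sym E'\<close> \<open>irrefl E'\<close> deg' False by blast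
          then have stS: "stable_set E S" and "\<not> (p \<in> S \<and> q \<in> S)"
            by (auto simp: stable_set_def E'_def)
          \<comment> \<open>Here \<open>z\<close> is \<open>x\<close> or \<open>y\<close>. Its only
            neighbour outside \<open>T\<close> is \<open>h z\<close>, which \<open>S\<close> avoids,
            so \<open>z\<close> can be added and pays for the three vertices of
            \<open>T\<close>.\<close>
          then obtain z where z: "z \<in> T" "h z \<notin> S" using xy p_def q_def by blast
          have "(z, s) \<notin> E" if "s \<in> S" for s
            using that z h[OF z(1)] S(1) by (auto simp: nbrs_def)
          moreover from this have "(s, z) \<notin> E" if "s \<in> S" for s using that symE by blast
          ultimately have "stable_set E (insert z S)"
            using stS irrE by (auto simp: stable_set_def)
          moreover have "card (insert z S) = Suc (card S)"
            using z(1) S(1) fin finite_subset[of S "V - T"] by (intro card_insert_disjoint) auto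
          moreover have "card V = 3 + card (V - T)"
            using cT TV finT card_mono[OF fin TV] by (simp add: card_Diff_subset)
          ultimately show ?thesis using S z TV by (intro exI[of _ "insert z S"]) auto
        next
          case True
          then obtain K where K: "K \<subseteq> V - T" "card K = 4" "clique E' K" by blast
          \<comment> \<open>As \<open>E\<close> has no K4, the clique \<open>K\<close> must use the
            new edge; hence \<open>p\<close> and \<open>q\<close> are in \<open>K\<close> and not
            adjacent in \<open>E\<close>.\<close>
          have "\<not> clique E K" using K noK4 by blast
          then have inK: "p \<in> K" "q \<in> K" and nadj: "(p, q) \<notin> E"
            using K(3) symE by (auto simp: clique_def E'_def)
          have "card (K - {p, q}) = 2"
            using inK K(2) pq(1) by (simp add: card_Diff_subset)
          then obtain r s where rs: "K - {p, q} = {r, s}" "r \<noteq> s" by (auto simp: card_2_iff)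
          then have mem: "r \<in> K" "s \<in> K" "r \<noteq> p" "r \<noteq> q" "s \<noteq> p" "s \<noteq> q" by auto
          then have adj: "(p, r) \<in> E" "(p, s) \<in> E" "(q, r) \<in> E" "(q, s) \<in> E"
            using K(3) inK by (auto simp: clique_def E'_def)
          have ne: "r \<noteq> x" "s \<noteq> x" "r \<noteq> y" "s \<noteq> y" using mem K(1) xy by auto
          \<comment> \<open>The degrees of \<open>p\<close> and \<open>q\<close> are now used up:
            each sees \<open>r\<close>, \<open>s\<close> and one vertex of \<open>T\<close>. So the
            stable pair \<open>p\<close>, \<open>q\<close> can be paid for by deleting these six
            vertices.\<close>
          have "nbrs E V p = {x, r, s}"
            using adj ne rs(2) pq mem K(1) xy TV fin deg
            by (intro nbrs_eq_triple) (auto simp: nbrs_def)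
          moreover have "nbrs E V q = {y, r, s}"
            using adj ne rs(2) pq mem K(1) xy TV fin deg
            by (intro nbrs_eq_triple) (auto simp: nbrs_def)
          moreover have "stable_set E {p, q}" using nadj symE irrE by (auto simp: stable_set_def)
          moreover have "card {p, q, x, y, r, s} \<le> 3 * card {p, q}"
            using pq(1) by (simp add: card_insert_if)
          moreover have "{p, q, x, y, r, s} \<subseteq> V" using pq mem K(1) xy TV by auto
          ultimately show ?thesis by (intro reduce[of "{p, q}" "{p, q, x, y, r, s}"]) auto
        qed
      qed
    qed
  qed
qed

section \<open>Structure of the graphs in \<open>class_G\<close> and the lower bound\<close>

context
  fixes G :: "'a pair_pre_digraph"
  assumes G: "G \<in> class_G"
begin

lemma class_G_finite: "finite (pverts G)"
  and class_G_sym: "sym (parcs G)"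
  and class_G_irrefl: "irrefl (parcs G)"
  and class_G_wf: "(u, v) \<in> parcs G \<Longrightarrow> u \<in> pverts G \<and> v \<in> pverts G"
proof -
  interpret pair_graph G using G by (simp add: class_G_def)
  show "finite (pverts G)" by (rule pair_finite_verts)
  show "sym (parcs G)" using pair_sym_arcs by (simp add: symmetric_def)
  show "irrefl (parcs G)" using pair_no_loops by (force simp: irrefl_def)
  show "(u, v) \<in> parcs G \<Longrightarrow> u \<in> pverts G \<and> v \<in> pverts G"
    by (blast dest: in_arcsD1 in_arcsD2)
qed

lemma out_degree_eq_card_nbrs: "out_degree (with_proj G) v = card (nbrs (parcs G) (pverts G) v)"
proof -
  have "out_arcs (with_proj G) v = Pair v ` nbrs (parcs G) (pverts G) v"
    using class_G_wf by (auto simp: out_arcs_def nbrs_def)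
  then show ?thesis by (simp add: out_degree_def card_image inj_on_def)
qed

text \<open>The form in which connectedness is used: by symmetry of the arcs every vertex is
  reachable from any vertex of \<open>C\<close>, and no walk leaves a closed set.\<close>

lemma class_G_closed_set:
  assumes "C \<subseteq> pverts G" "C \<noteq> {}" and cl: "\<And>u v. \<lbrakk>u \<in> C; (u, v) \<in> parcs G\<rbrakk> \<Longrightarrow> v \<in> C"
  shows "C = pverts G"
proof -
  obtain a where a: "a \<in> C" using assms(2) by blast
  have "b \<in> C" if "b \<in> pverts G" for b
  proof -
    interpret pair_graph G using G by (simp add: class_G_def)
    have "strongly_connected (with_proj G)"
      using G pair_sym_arcs symmetric_connected_imp_strongly_connected by (simp add: class_G_def)
    then have "a \<rightarrow>\<^sup>*\<^bsub>with_proj G\<^esub> b" using a assms(1) that by (auto simp: strongly_connected_def)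
    then show "b \<in> C" by (induct rule: reachable_induct) (use a cl in auto)
  qed
  then show ?thesis using assms(1) by blast
qed

text \<open>An isolated vertex would form a closed set, hence be the whole graph, against the bound
  of three vertices.\<close>

lemma class_G_nbrs_nonempty:
  assumes "v \<in> pverts G" shows "nbrs (parcs G) (pverts G) v \<noteq> {}"
proof
  assume "nbrs (parcs G) (pverts G) v = {}"
  then have "{v} = pverts G"
    using assms class_G_wf by (intro class_G_closed_set) (auto simp: nbrs_def)
  then have "card (pverts G) = 1" by (metis is_singletonI is_singleton_altdef)
  then show False using G by (simp add: class_G_def)
qed

lemma class_G_card_nbrs: "v \<in> pverts G \<Longrightarrow> card (nbrs (parcs G) (pverts G) v) \<le> 3"
  using G out_degree_eq_card_nbrs by (simp add: class_G_def)

text \<open>Each vertex of a K4 already has degree 3 inside it, so the K4 is a closed set and the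
  whole graph, which \<open>class_G\<close> excludes.\<close>

lemma class_G_no_K4:
  assumes "K \<subseteq> pverts G" "card K = 4"
  shows "\<not> clique (parcs G) K"
proof
  assume cl: "clique (parcs G) K"
  have "finite K" using assms(2) card.infinite by fastforce
  have "K = pverts G"
  proof (rule class_G_closed_set)
    fix u v assume u: "u \<in> K" and uv: "(u, v) \<in> parcs G"
    have "K - {u} = nbrs (parcs G) (pverts G) u"
    proof (rule card_seteq)
      show "finite (nbrs (parcs G) (pverts G) u)" using class_G_finite by (simp add: nbrs_def)
      show "K - {u} \<subseteq> nbrs (parcs G) (pverts G) u"
        using cl u assms(1) by (auto simp: clique_def nbrs_def)
      show "card (nbrs (parcs G) (pverts G) u) \<le> card (K - {u})"
        using class_G_card_nbrs[of u] u assms \<open>finite K\<close> by auto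
    qed
    then show "v \<in> K" using uv class_G_wf by (auto simp: nbrs_def)
  qed (use assms in auto)
  then have "(u, v) \<in> parcs G" if "u \<in> pverts G" "v \<in> pverts G" "u \<noteq> v" for u v
    using cl that by (simp add: clique_def)
  moreover have "(u, u) \<notin> parcs G" for u using class_G_irrefl by (simp add: irrefl_def)
  ultimately have "parcs G = {(u, v). (u, v) \<in> pverts G \<times> pverts G \<and> u \<noteq> v}"
    using class_G_wf by blast
  moreover have "card (pverts G) = 4" using assms(2) unfolding \<open>K = pverts G\<close> .
  ultimately have "complete_digraph 4 (with_proj G)"
    unfolding complete_digraph_pair_def using class_G_finite by blast
  then show False using G by (simp add: class_G_def)
qed

text \<open>Degree 0 is impossible by connectedness. This turns the right-hand side of the theorem
  into a third of \<open>card (pverts G) + card (degree_class G 1)\<close>.\<close>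

lemma card_pverts_eq_sum_degree_classes:
  "card (pverts G)
     = card (degree_class G 1) + card (degree_class G 2) + card (degree_class G 3)"
proof -
  have "out_degree (with_proj G) v \<in> {1, 2, 3}" if "v \<in> pverts G" for v
  proof -
    have "card (nbrs (parcs G) (pverts G) v) \<noteq> 0"
      using class_G_nbrs_nonempty[OF that] class_G_finite by (simp add: nbrs_def)
    then show ?thesis
      using class_G_card_nbrs[OF that] unfolding out_degree_eq_card_nbrs
      by (simp add: le_Suc_eq numeral_3_eq_3 numeral_2_eq_2)
  qed
  then have "pverts G = degree_class G 1 \<union> degree_class G 2 \<union> degree_class G 3"
    by (auto simp: degree_class_def)
  moreover have "finite (degree_class G i)" for i
    using class_G_finite by (simp add: degree_class_def)
  moreover have "degree_class G i \<inter> degree_class G j = {}" if "i \<noteq> j" for i j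
    using that by (auto simp: degree_class_def)
  ultimately show ?thesis by (simp add: card_Un_disjoint Int_Un_distrib2)
qed

text \<open>All leaves are taken into the stable set; what is left after removing them and their
  neighbours has at least \<open>card (pverts G) - 2 * card (degree_class G 1)\<close> vertices,
  a third of which can be added.\<close>

lemma class_G_stable:
  "\<exists>S \<subseteq> pverts G. stable_set (parcs G) S
     \<and> card (pverts G) + card (degree_class G 1) \<le> 3 * card S"
proof -
  define V where "V = pverts G"
  define E where "E = parcs G"
  define L where "L = degree_class G 1"
  define N where "N = (\<Union>l\<in>L. nbrs E V l)"
  have fin: "finite V" "finite L" "finite N" and LV: "L \<subseteq> V" and NV: "N \<subseteq> V"
    using class_G_finite by (auto simp: V_def L_def N_def degree_class_def nbrs_def)
  have symE: "(a, b) \<in> E \<Longrightarrow> (b, a) \<in> E" for a b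
    using class_G_sym unfolding E_def by (rule symD)
  have leaf: "card (nbrs E V l) = 1" if "l \<in> L" for l
    using that out_degree_eq_card_nbrs by (simp add: L_def degree_class_def E_def V_def)
  have stL: "stable_set E L"
    unfolding stable_set_def
  proof (intro ballI notI)
    fix l m assume lm: "l \<in> L" "m \<in> L" "(l, m) \<in> E"
    \<comment> \<open>Two adjacent leaves have no other neighbours, so they would form a closed set
      and the graph would have only two vertices.\<close>
    have "nbrs E V a = {b}" if ab: "a \<in> L" "b \<in> V" "(a, b) \<in> E" for a b
    proof -
      obtain c where "nbrs E V a = {c}" using leaf[OF ab(1)] by (rule card_1_singletonE)
      moreover have "b \<in> nbrs E V a" using ab by (simp add: nbrs_def)
      ultimately show ?thesis by simp
    qed
    then have "nbrs E V l = {m}" "nbrs E V m = {l}" using lm LV symE by blast+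
    then have "{l, m} = V"
      unfolding V_def using lm LV class_G_wf
      by (intro class_G_closed_set) (auto simp: nbrs_def V_def E_def)
    then have "card V \<le> 2" using card_insert_le_m1[of 2 "{m}" l] by auto
    then show False using G by (simp add: class_G_def V_def)
  qed
  have "card N \<le> (\<Sum>l\<in>L. card (nbrs E V l))"
    unfolding N_def using fin by (intro card_UN_le) auto
  then have cN: "card N \<le> card L" using leaf by simp
  \<comment> \<open>Removing \<open>N\<close> separates \<open>H\<close> from the leaves.
    \<open>H\<close> may be disconnected, which \<open>subcubic_stable\<close> allows.\<close>
  define H where "H = V - (L \<union> N)"
  have "\<exists>S \<subseteq> H. stable_set E S \<and> card H \<le> 3 * card S"
  proof (rule subcubic_stable)
    show "finite H" "sym E" "irrefl E"
      using fin class_G_sym class_G_irrefl by (auto simp: H_def E_def)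
    show "\<not> clique E K" if "K \<subseteq> H" "card K = 4" for K
      using that class_G_no_K4[of K] by (auto simp: H_def V_def E_def)
    show "card (nbrs E H v) \<le> 3" if "v \<in> H" for v
    proof -
      have "card (nbrs E H v) \<le> card (nbrs E V v)"
        using fin by (intro card_mono) (auto simp: nbrs_def H_def)
      then show ?thesis using class_G_card_nbrs[of v] that by (simp add: H_def V_def E_def)
    qed
  qed
  then obtain S where S: "S \<subseteq> H" "stable_set E S" "card H \<le> 3 * card S" by blast
  have "(l, s) \<notin> E" if "l \<in> L" "s \<in> S" for l s
    using that S(1) by (auto simp: H_def N_def nbrs_def)
  moreover from this have "(s, l) \<notin> E" if "l \<in> L" "s \<in> S" for l s
    using that symE by blast
  ultimately have "stable_set E (L \<union> S)"
    using stL S(2) by (auto simp: stable_set_def)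
  moreover have "card (L \<union> S) = card L + card S"
    using S(1) fin finite_subset[of S V] by (intro card_Un_disjoint) (auto simp: H_def)
  moreover have "card V - card (L \<union> N) \<le> card H"
    unfolding H_def using fin by (intro diff_card_le_card_Diff) auto
  moreover have "card (L \<union> N) \<le> card L + card N" by (rule card_Un_le)
  moreover have "L \<union> S \<subseteq> V" using LV S(1) by (auto simp: H_def)
  \<comment> \<open>\<open>3 * card S\<close> is at least \<open>card V - 2 * card L\<close>, and
    the leaves add \<open>3 * card L\<close>, giving \<open>card V + card L\<close>.\<close>
  ultimately show ?thesis
    using S(3) cN by (intro exI[of _ "L \<union> S"]) (auto simp: V_def E_def L_def)
qed

end

section \<open>The independence number and the upper bounds for \<open>class_A\<close> and
  \<open>class_B\<close>\<close>

lemma card_le_independence_number: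
  assumes "finite (pverts G)" "independent_set G S"
  shows "card S \<le> independence_number G"
proof -
  have "finite {S. independent_set G S}"
    using assms(1) by (simp add: independent_set_def)
  then show ?thesis
    unfolding independence_number_def using assms(2) by (intro Max_ge) auto
qed

lemma independence_number_attained:
  assumes "finite (pverts G)"
  obtains S where "independent_set G S" "card S = independence_number G"
proof -
  have "finite {S. independent_set G S}"
    using assms by (simp add: independent_set_def)
  moreover have "independent_set G {}" by (simp add: independent_set_def)
  ultimately have "independence_number G \<in> card ` {S. independent_set G S}"
    unfolding independence_number_def by (intro Max_in) auto
  then show thesis using that by auto
qed

text \<open>The triangles of the construction partition the vertices, and an independent set meets
  each at most once. Finiteness is carried along because the cardinalities of the disjoint parts are
  added.\<close>

lemma class_A_independent:
  assumes "G \<in> class_A" "independent_set G S"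
  shows "finite (pverts G) \<and> 3 * card S \<le> card (pverts G)"
  using assms
proof (induction arbitrary: S)
  case (triangle T)
  then have T: "finite (pverts T)" "card (pverts T) = 3"
    "parcs T = {(u, v). (u, v) \<in> pverts T \<times> pverts T \<and> u \<noteq> v}"
    by (auto simp: complete_digraph_pair_def)
  moreover have "S \<subseteq> pverts T" "\<forall>a \<in> S. \<forall>b \<in> S. a = b"
    using triangle.prems unfolding independent_set_def T(3) by blast+
  ultimately have "card S \<le> 1"
    using finite_subset[of S "pverts T"] by (auto simp: card_le_Suc0_iff_eq)
  then show ?case using T by simp
next
  case (attach_triangle G x T y)
  then have T: "finite (pverts T)" "card (pverts T) = 3"
    "parcs T = {(u, v). (u, v) \<in> pverts T \<times> pverts T \<and> u \<noteq> v}"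
    by (auto simp: complete_digraph_pair_def)
  have ind: "independent_set G (S \<inter> pverts G)" "S \<subseteq> pverts G \<union> pverts T"
    using attach_triangle.prems by (auto simp: independent_set_def)
  have "card (S \<inter> pverts T) \<le> 1"
    using T attach_triangle.prems by (auto simp: card_le_Suc0_iff_eq independent_set_def)
  moreover have "finite (pverts G)" "3 * card (S \<inter> pverts G) \<le> card (pverts G)"
    using attach_triangle.IH ind(1) by auto
  moreover have "S = (S \<inter> pverts G) \<union> (S \<inter> pverts T)" using ind(2) by auto
  then have "card S \<le> card (S \<inter> pverts G) + card (S \<inter> pverts T)"
    by (metis card_Un_le)
  ultimately show ?case
    using T attach_triangle.hyps by (simp add: card_Un_disjoint)
qed

text \<open>The pendant edges form a perfect matching, so a stable set contains at most half of the
  vertices, and the other half consists of leaves.\<close>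

lemma class_B_independent:
  assumes "G \<in> class_B" "independent_set G S"
  shows "3 * card S \<le> card (pverts G) + card (degree_class G 1)"
proof -
  obtain n P f where P: "path_graph n P" and inj: "inj_on f (pverts P)"
    and disj: "f ` pverts P \<inter> pverts P = {}"
    and G: "G = \<lparr>pverts = pverts P \<union> f ` pverts P,
      parcs = parcs P \<union> {(v, f v) |v. v \<in> pverts P} \<union> {(f v, v) |v. v \<in> pverts P}\<rparr>"
    using assms(1) by (auto simp: class_B_def)
  have fin: "finite (pverts P)" and wf: "\<And>u v. (u, v) \<in> parcs P \<Longrightarrow> u \<in> pverts P"
    using P by (auto simp: path_graph_def)
  \<comment> \<open>Each leaf in \<open>S\<close> is moved to its path vertex. The result is
    disjoint from \<open>S \<inter> pverts P\<close>, as \<open>S\<close> never contains both ends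
    of a pendant edge.\<close>
  define A where "A = {v \<in> pverts P. f v \<in> S}"
  have S: "S \<subseteq> pverts P \<union> f ` pverts P" "\<And>v. v \<in> pverts P \<Longrightarrow> \<not> (v \<in> S \<and> f v \<in> S)"
    using assms(2) by (auto simp: G independent_set_def)
  have "S = (S \<inter> pverts P) \<union> f ` A" using S(1) by (auto simp: A_def)
  then have "card S \<le> card (S \<inter> pverts P) + card (f ` A)" by (metis card_Un_le)
  also have "\<dots> \<le> card (S \<inter> pverts P) + card A"
    using fin by (simp add: A_def card_image_le)
  also have "\<dots> = card ((S \<inter> pverts P) \<union> A)"
    using fin S(2) by (intro card_Un_disjoint[symmetric]) (auto simp: A_def)
  also have "\<dots> \<le> card (pverts P)" using fin by (intro card_mono) (auto simp: A_def)
  finally have "card S \<le> card (pverts P)" .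
  moreover have cf: "card (f ` pverts P) = card (pverts P)" using inj by (rule card_image)
  moreover have "card (pverts G) = card (pverts P) + card (f ` pverts P)"
    using fin disj by (simp add: G card_Un_disjoint Int_commute)
  moreover have "f ` pverts P \<subseteq> degree_class G 1"
  proof
    fix w assume "w \<in> f ` pverts P"
    then obtain v where v: "v \<in> pverts P" "w = f v" by blast
    \<comment> \<open>The vertex \<open>f v\<close> lies off the path, so it has only pendant arcs,
      and by injectivity of \<open>f\<close> only the one to \<open>v\<close>.\<close>
    then have "out_arcs (with_proj G) w = {(w, v)}"
      using wf disj inj by (auto simp: out_arcs_def G dest: inj_onD)
    then show "w \<in> degree_class G 1" using v by (simp add: degree_class_def out_degree_def G)
  qed
  then have "card (f ` pverts P) \<le> card (degree_class G 1)"
    using fin by (intro card_mono) (auto simp: degree_class_def G)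
  ultimately show ?thesis by simp
qed

theorem theorem6:
  fixes G :: "'a pair_pre_digraph"
  assumes "G \<in> class_G"
  shows "real (independence_number G) \<ge>
           2 / 3 * real (card (degree_class G 1)) + 1 / 3 * real (card (degree_class G 2))
             + 1 / 3 * real (card (degree_class G 3)) \<and>
         (G \<in> class_A \<union> class_B \<longrightarrow>
           real (independence_number G) =
             2 / 3 * real (card (degree_class G 1)) + 1 / 3 * real (card (degree_class G 2))
               + 1 / 3 * real (card (degree_class G 3)))"
proof -
  have fin: "finite (pverts G)" using assms by (rule class_G_finite)
  \<comment> \<open>After multiplication by 3, both claims compare
    \<open>3 * independence_number G\<close> with
    \<open>card (pverts G) + card (degree_class G 1)\<close>.\<close>
  have n: "card (pverts G)
      = card (degree_class G 1) + card (degree_class G 2) + card (degree_class G 3)"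
    using assms by (rule card_pverts_eq_sum_degree_classes)
  obtain S where "independent_set G S"
    "card (pverts G) + card (degree_class G 1) \<le> 3 * card S"
    using class_G_stable[OF assms] by (auto simp: independent_set_def stable_set_def)
  then have lower: "card (pverts G) + card (degree_class G 1) \<le> 3 * independence_number G"
    using card_le_independence_number[OF fin] by fastforce
  have upper: "3 * independence_number G \<le> card (pverts G) + card (degree_class G 1)"
    if "G \<in> class_A \<union> class_B"
  proof -
    obtain T where T: "independent_set G T" "card T = independence_number G"
      using independence_number_attained[OF fin] .
    then show ?thesis
      using that class_A_independent[of G T] class_B_independent[of G T] by auto
  qed
  show ?thesis
    using lower upper n by (auto simp: field_simps)
qed

end
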